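(* Let $\mathrm{k}$ be a field of characteristic zero and let $\tilde M_0=(\tilde M_{0,ij})_{i,j\ge1}$ be the infinite matrix with entries $\tilde M_{0,ij}=i^{\,j-1}\left(x^i+(-1)^{j}\right)\in\mathrm{k}[x]$. The LU-decomposition of $\tilde M_0$ is $$\tilde M_0=\tilde L_0\cdot\left(\tilde U_0\,F\,\Sigma\right),$$ where $\tilde L_0$ is the lower triangular matrix with $$(\tilde L_0)_{ij}=(-1)^{i-j}\,p_{i-j}^{-i,-i}(x)\quad (i\ge j),$$ $\tilde U_0$ is the upper triangular matrix with $$(\tilde U_0)_{ij}=(-1)^{i-j}\,\frac{j}{i}\,(x-1)^{2i-j}\,p_{j-i}^{-j,-1}(x)\quad(i\le j),$$ $F$ is the diagonal matrix $F_{ij}=\delta_{ij}\,(i-1)!$, and $\Sigma$ is the upper triangular matrix of signed Stirling numbers of the second kind $\Sigma_{ij}=(-1)^{i+j}S(j,i)$ ($i\le j$).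
   Context: Matrices are infinite, indexed by $i,j\ge1$, with entries in $\mathrm{k}(x)$; unspecified entries of triangular matrices are zero. LU-decomposition means a lower triangular matrix with $1$'s on the diagonal times an upper triangular matrix. $S(n,m)=\frac1{m!}\sum_{k=0}^m(-1)^k\binom{m}{k}(m-k)^n$ is the Stirling number of the second kind. For integers $n\ge0$ and rational $\alpha,\beta$, the Jacobi polynomial is $$P^{\alpha,\beta}_n(x)=\frac1{n!}\sum_{k=0}^n\binom{n}{k}(n+\alpha+\beta+1)\cdots(n+\alpha+\beta+k)\,(\alpha+k+1)\cdots(\alpha+n)\left(\frac{x-1}{2}\right)^k$$ (empty products equal $1$), and $p_n^{\alpha,\beta}(x)=(x-1)^nP_n^{\alpha,\beta}\left(\frac{x+1}{x-1}\right)$, which is a polynomial in $x$. *)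

theory Defs
  imports
    "HOL-Computational_Algebra.Computational_Algebra"
    "HOL-Combinatorics.Stirling"
begin

text \<open>The rational function field \<open>k(x)\<close> is \<^typ>\<open>'k poly fract\<close>.\<close>

definition xvar :: "'k::field poly fract" where
  "xvar = to_fract [:0, 1:]"

definition const_fract :: "'k::field \<Rightarrow> 'k poly fract" where
  "const_fract c = to_fract [:c:]"


text \<open>Infinite matrices are functions \<^typ>\<open>nat \<Rightarrow> nat \<Rightarrow> 'a\<close> of which only the entries
  with both indices at least 1 are meaningful.\<close>

text \<open>The sum runs over the nonzero terms only, so that it is the intended one whenever
  there are finitely many of them (otherwise it is 0). Every product used below has a lower
  triangular left factor or an upper triangular right factor, so it is of this kind.\<close>

definition imat_mult :: "(nat \<Rightarrow> nat \<Rightarrow> 'a::semiring_0) \<Rightarrow> (nat \<Rightarrow> nat \<Rightarrow> 'a) \<Rightarrow> nat \<Rightarrow> nat \<Rightarrow> 'a"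
    (infixl "\<odot>" 70) where
  "(A \<odot> B) i j = (\<Sum>k | k \<ge> 1 \<and> A i k * B k j \<noteq> 0. A i k * B k j)"

definition unit_lower_triangular :: "(nat \<Rightarrow> nat \<Rightarrow> 'a::semiring_1) \<Rightarrow> bool" where
  "unit_lower_triangular L \<longleftrightarrow>
     (\<forall>i\<ge>1. L i i = 1) \<and> (\<forall>i\<ge>1. \<forall>j\<ge>1. i < j \<longrightarrow> L i j = 0)"

definition upper_triangular_imat :: "(nat \<Rightarrow> nat \<Rightarrow> 'a::zero) \<Rightarrow> bool" where
  "upper_triangular_imat U \<longleftrightarrow> (\<forall>i\<ge>1. \<forall>j\<ge>1. j < i \<longrightarrow> U i j = 0)"

definition imat_eq :: "(nat \<Rightarrow> nat \<Rightarrow> 'a) \<Rightarrow> (nat \<Rightarrow> nat \<Rightarrow> 'a) \<Rightarrow> bool" where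
  "imat_eq A B \<longleftrightarrow> (\<forall>i\<ge>1. \<forall>j\<ge>1. A i j = B i j)"

definition LU_decomposition ::
    "(nat \<Rightarrow> nat \<Rightarrow> 'a::semiring_1) \<Rightarrow> (nat \<Rightarrow> nat \<Rightarrow> 'a) \<Rightarrow> (nat \<Rightarrow> nat \<Rightarrow> 'a) \<Rightarrow> bool" where
  "LU_decomposition M L U \<longleftrightarrow>
     unit_lower_triangular L \<and> upper_triangular_imat U \<and> imat_eq M (L \<odot> U)"

text \<open>The convention on products, confirmed for a lower triangular left factor and for an
  upper triangular right factor.\<close>

lemma imat_mult_lower:
  assumes "\<And>k. i < k \<Longrightarrow> A i k = 0"
  shows "(A \<odot> B) i j = (\<Sum>k=1..i. A i k * B k j)"
  unfolding imat_mult_def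
proof (rule sum.mono_neutral_left)
  show "{k. k \<ge> 1 \<and> A i k * B k j \<noteq> 0} \<subseteq> {1..i}"
  proof
    fix k assume "k \<in> {k. k \<ge> 1 \<and> A i k * B k j \<noteq> 0}"
    then have "k \<ge> 1" and "A i k * B k j \<noteq> 0" by simp_all
    then have "\<not> i < k" using assms[of k] by auto
    with \<open>k \<ge> 1\<close> show "k \<in> {1..i}" by simp
  qed
qed auto

lemma imat_mult_upper:
  assumes "\<And>k. j < k \<Longrightarrow> B k j = 0"
  shows "(A \<odot> B) i j = (\<Sum>k=1..j. A i k * B k j)"
  unfolding imat_mult_def
proof (rule sum.mono_neutral_left)
  show "{k. k \<ge> 1 \<and> A i k * B k j \<noteq> 0} \<subseteq> {1..j}"
  proof
    fix k assume "k \<in> {k. k \<ge> 1 \<and> A i k * B k j \<noteq> 0}"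
    then have "k \<ge> 1" and "A i k * B k j \<noteq> 0" by simp_all
    then have "\<not> j < k" using assms[of k] by auto
    with \<open>k \<ge> 1\<close> show "k \<in> {1..j}" by simp
  qed
qed auto


definition jacobi :: "nat \<Rightarrow> rat \<Rightarrow> rat \<Rightarrow> 'k::field_char_0 poly" where
  "jacobi n \<alpha> \<beta> = smult (1 / fact n)
     (\<Sum>k=0..n. smult (of_nat (n choose k)
          * of_rat (\<Prod>l=1..k. of_nat n + \<alpha> + \<beta> + of_nat l)
          * of_rat (\<Prod>l=k+1..n. \<alpha> + of_nat l))
        ([:- 1 / 2, 1 / 2:] ^ k))"

definition jacobi_p :: "nat \<Rightarrow> rat \<Rightarrow> rat \<Rightarrow> 'k::field_char_0 poly fract" where
  "jacobi_p n \<alpha> \<beta> =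
     (xvar - 1) ^ n * poly (map_poly const_fract (jacobi n \<alpha> \<beta>)) ((xvar + 1) / (xvar - 1))"

lemma const_fract_simps [simp]:
  "const_fract 0 = 0" "const_fract 1 = 1"
  "const_fract (a + b) = const_fract a + const_fract b"
  "const_fract (a * b) = const_fract a * const_fract b"
  unfolding const_fract_def
  by (simp_all flip: to_fract_add to_fract_mult one_pCons)

lemma map_poly_const_fract_simps:
  "map_poly const_fract (p + q) = map_poly const_fract p + map_poly const_fract q"
  "map_poly const_fract (p * q) = map_poly const_fract p * map_poly const_fract q"
proof -
  show add: "map_poly const_fract (p + q) = map_poly const_fract p + map_poly const_fract q"
    for p q :: "'k::field poly"
    by (rule poly_eqI) (simp add: coeff_map_poly)
  have smult: "map_poly const_fract (smult a p) = smult (const_fract a) (map_poly const_fract p)"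
    for a and p :: "'k::field poly"
    by (rule poly_eqI) (simp add: coeff_map_poly)
  show "map_poly const_fract (p * q) = map_poly const_fract p * map_poly const_fract q"
    by (induction p) (simp_all add: add smult map_poly_pCons mult_pCons_left)
qed

lemma xvar_minus_1_nonzero: "(xvar :: 'k::field poly fract) - 1 \<noteq> 0"
proof -
  have "(xvar :: 'k poly fract) - 1 = to_fract [:- 1, 1:]"
    unfolding xvar_def by (simp flip: to_fract_1 to_fract_diff add: one_pCons)
  then show ?thesis by simp
qed

lemma jacobi_p_polynomial:
  "jacobi_p n \<alpha> \<beta> = to_fract (smult (1 / fact n)
     (\<Sum>k=0..n. smult (of_nat (n choose k)
          * of_rat (\<Prod>l=1..k. of_nat n + \<alpha> + \<beta> + of_nat l)
          * of_rat (\<Prod>l=k+1..n. \<alpha> + of_nat l))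
        ([:- 1, 1:] ^ (n - k)) :: 'k::field_char_0 poly))"
proof -
  let ?y = "(xvar + 1) / (xvar - 1) :: 'k poly fract"
  define ev :: "'k poly \<Rightarrow> 'k poly fract" where "ev p = poly (map_poly const_fract p) ?y" for p
  have ev_add: "ev (p + q) = ev p + ev q" and ev_mult: "ev (p * q) = ev p * ev q" for p q
    by (simp_all add: ev_def map_poly_const_fract_simps)
  have ev_C: "ev [:c:] = const_fract c" for c
    by (simp add: ev_def map_poly_pCons)
  have ev_smult: "ev (smult c p) = const_fract c * ev p" for c p
    using ev_mult[of "[:c:]" p] by (simp add: ev_C)
  have ev_0: "ev 0 = 0" by (simp add: ev_def)
  have ev_sum: "ev (sum f A) = (\<Sum>a\<in>A. ev (f a))" for f :: "nat \<Rightarrow> _" and A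
    by (induction A rule: infinite_finite_induct) (simp_all add: ev_0 ev_add)
  have ev_1: "ev 1 = 1" by (simp add: ev_def)
  have ev_power: "ev (p ^ m) = ev p ^ m" for p m
    by (induction m) (simp_all add: ev_1 ev_mult)
  have X1: "(xvar :: 'k poly fract) - 1 = to_fract [:- 1, 1:]"
    unfolding xvar_def by (simp flip: to_fract_1 to_fract_diff add: one_pCons)
  have "xvar - 1 \<noteq> (0 :: 'k poly fract)" by (rule xvar_minus_1_nonzero)
  have two: "const_fract (1 / 2) * 2 = (1 :: 'k poly fract)"
    using const_fract_simps(4)[of "1/2" "2::'k"] const_fract_simps(3)[of 1 "1::'k"]
    by (simp del: const_fract_simps(3,4))
  have half: "ev [:- 1 / 2, 1 / 2:] = inverse (xvar - 1)"
  proof -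
    have "[:- 1 / 2, 1 / 2:] = smult (1/2) ([:0, 1:] + [:-1:] :: 'k poly)" by simp
    moreover have "const_fract (- 1) = (- 1 :: 'k poly fract)"
      using const_fract_simps(3)[of "-1" "1::'k"] by (simp add: eq_neg_iff_add_eq_0 del: const_fract_simps(3))
    moreover have "ev [:0, 1:] = ?y" by (simp add: ev_def map_poly_pCons)
    ultimately have "ev [:- 1 / 2, 1 / 2:] = const_fract (1/2) * (?y - 1)"
      by (simp only: ev_smult ev_add ev_C) simp
    also have "?y - 1 = 2 * inverse (xvar - 1)"
      using \<open>xvar - 1 \<noteq> (0 :: 'k poly fract)\<close> by (simp add: field_simps)
    finally show ?thesis using two by (metis mult.assoc mult_1)
  qed
  have pw: "(xvar - 1) ^ n * inverse (xvar - 1) ^ k = (to_fract ([:- 1, 1:] ^ (n - k)) :: 'k poly fract)"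
    if "k \<le> n" for k
  proof -
    have tp: "to_fract (q ^ m) = to_fract q ^ m" for q :: "'k poly" and m
      by (induction m) simp_all
    have "(xvar - 1) ^ n = (xvar - 1) ^ (n - k) * (xvar - 1 :: 'k poly fract) ^ k"
      using that by (simp flip: power_add)
    then show ?thesis
      using \<open>xvar - 1 \<noteq> (0 :: 'k poly fract)\<close> unfolding tp X1[symmetric]
      by (simp add: power_inverse)
  qed
  have sm: "to_fract (smult c q) = const_fract c * to_fract q" for c and q :: "'k poly"
    by (simp add: const_fract_def flip: to_fract_mult)
  show ?thesis
    unfolding jacobi_p_def jacobi_def ev_def[symmetric] ev_smult ev_sum ev_power half sm
      to_fract_sum sum_distrib_left
    by (rule sum.cong) (auto simp only: pw[symmetric] atLeastAtMost_iff mult_ac)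
qed


text \<open>\<^const>\<open>Stirling\<close> is given by its recurrence; this is the closed form.\<close>

lemma Stirling_closed_form:
  "of_nat (Stirling n m) =
     (1 / fact m :: 'k::field_char_0) * (\<Sum>k=0..m. (- 1) ^ k * of_nat (m choose k) * of_nat (m - k) ^ n)"
proof -
  define f :: "nat \<Rightarrow> nat \<Rightarrow> 'k" where
    "f n m = (\<Sum>k=0..m. (- 1) ^ k * of_nat (m - k) ^ n / (fact k * fact (m - k)))" for n m
  have f_alt: "f n m = (1 / fact m) * (\<Sum>k=0..m. (- 1) ^ k * of_nat (m choose k) * of_nat (m - k) ^ n)"
    for n m
    unfolding f_def sum_distrib_left
    by (rule sum.cong) (auto simp: binomial_fact field_simps)
  have f_0: "f n 0 = (if n = 0 then 1 else 0)" for n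
    by (simp add: f_def)
  have f_0_Suc: "f 0 (Suc m) = 0" for m
  proof -
    have "(\<Sum>k\<le>Suc m. (- 1) ^ k * of_nat (Suc m choose k)) = (0 :: 'k)"
      by (rule choose_alternating_sum) simp
    then show ?thesis by (simp add: f_alt atMost_atLeast0 del: sum.cl_ivl_Suc binomial_Suc_Suc)
  qed
  have f_Suc: "f (Suc n) (Suc m) = of_nat (Suc m) * f n (Suc m) + f n m" for n m
  proof -
    let ?M = "Suc m"
    have "f (Suc n) ?M - of_nat ?M * f n ?M =
        (\<Sum>k=0..?M. - of_nat k * ((- 1) ^ k * of_nat (?M - k) ^ n / (fact k * fact (?M - k))))"
      unfolding f_def sum_distrib_left sum_subtractf[symmetric]
    proof (rule sum.cong)
      fix k assume "k \<in> {0..?M}"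
      then have e: "(of_nat (?M - k) :: 'k) = of_nat ?M - of_nat k" by (simp only: of_nat_diff atLeastAtMost_iff)
      define t :: 'k where "t = (- 1) ^ k * of_nat (?M - k) ^ n / (fact k * fact (?M - k))"
      have "(- 1) ^ k * of_nat (?M - k) ^ Suc n / (fact k * fact (?M - k)) = of_nat (?M - k) * t"
        unfolding t_def by (simp only: power_Suc times_divide_eq_right mult.left_commute)
      also have "\<dots> - of_nat ?M * t = - of_nat k * t"
        unfolding e left_diff_distrib by simp
      finally show "(- 1) ^ k * of_nat (?M - k) ^ Suc n / (fact k * fact (?M - k))
          - of_nat ?M * ((- 1) ^ k * of_nat (?M - k) ^ n / (fact k * fact (?M - k)))
          = - of_nat k * ((- 1) ^ k * of_nat (?M - k) ^ n / (fact k * fact (?M - k)) :: 'k)"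
        unfolding t_def .
    qed simp
    also have "\<dots> = (\<Sum>k=0..m. - of_nat (Suc k)
        * ((- 1) ^ Suc k * of_nat (?M - Suc k) ^ n / (fact (Suc k) * fact (?M - Suc k))))"
      by (subst sum.atLeast0_atMost_Suc_shift) (simp only: of_nat_0 comp_def, simp)
    also have "\<dots> = f n m"
      unfolding f_def by (rule sum.cong) (simp_all add: field_simps del: of_nat_Suc)
    finally show ?thesis by (simp add: algebra_simps)
  qed
  have "of_nat (Stirling n m) = f n m"
    by (induction n m rule: Stirling.induct) (simp_all add: f_0 f_0_Suc f_Suc algebra_simps)
  then show ?thesis by (simp add: f_alt)
qed


definition M0_mat :: "nat \<Rightarrow> nat \<Rightarrow> 'k::field_char_0 poly fract" where
  "M0_mat i j = of_nat i ^ (j - 1) * (xvar ^ i + (- 1) ^ j)"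

definition L0_mat :: "nat \<Rightarrow> nat \<Rightarrow> 'k::field_char_0 poly fract" where
  "L0_mat i j =
     (if j \<le> i then (- 1) ^ (i - j) * jacobi_p (i - j) (- of_nat i) (- of_nat i) else 0)"

definition U0_mat :: "nat \<Rightarrow> nat \<Rightarrow> 'k::field_char_0 poly fract" where
  "U0_mat i j =
     (if i \<le> j then (- 1) powi (int i - int j) * (of_nat j / of_nat i)
        * (xvar - 1) powi (2 * int i - int j) * jacobi_p (j - i) (- of_nat j) (- 1)
      else 0)"

definition F_mat :: "nat \<Rightarrow> nat \<Rightarrow> 'k::field_char_0 poly fract" where
  "F_mat i j = (if i = j then of_nat (fact (i - 1)) else 0)"

definition Sigma_mat :: "nat \<Rightarrow> nat \<Rightarrow> 'k::field_char_0 poly fract" where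
  "Sigma_mat i j = (if i \<le> j then (- 1) ^ (i + j) * of_nat (Stirling j i) else 0)"

end

theory Submission
  imports Defs
begin

text \<open>The Jacobi polynomials in \<open>L\<^sub>0\<close> are power series coefficients: the \<open>j\<close>-th column of
  \<open>L\<^sub>0\<close> lists those of \<open>g\<^sup>j\<close>, where \<open>g = t / ((1 - x t) (1 - t))\<close>. Put \<open>a = 1 / (1 - x t)\<close> and
  \<open>b = - t / (1 - t)\<close>. Then \<open>a b = - g\<close> and \<open>a + b = 1 + (x - 1) g\<close>, so the Girard-Waring
  formula expresses \<open>a\<^sup>j + b\<^sup>j\<close> as a polynomial in \<open>g\<close>, and its coefficients are the entries of
  the \<open>j\<close>-th column of \<open>U\<^sub>0\<close>. Hence \<open>(L\<^sub>0 U\<^sub>0)\<^sub>i\<^sub>j\<close> is the \<open>t\<^sup>i\<close>-coefficient of \<open>a\<^sup>j + b\<^sup>j\<close>, a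
  combination of two binomial coefficients, and the factors \<open>F\<close> and \<open>\<Sigma>\<close> turn it into powers of
  \<open>i\<close> by the expansions of \<open>i\<^sup>j\<close> and \<open>(-i)\<^sup>j\<close> in rising factorials.\<close>

text \<open>Lets the binomial, Pochhammer and power series identities over
  \<open>field_char_0\<close> be applied with coefficients in k(x).\<close>

instance fract :: ("{idom, ring_char_0}") field_char_0
proof
  show "inj (of_nat :: nat \<Rightarrow> 'a fract)"
    by (rule injI) (simp add: of_nat_fract eq_fract)
qed

section \<open>Uniqueness of LU-decompositions\<close>

text \<open>Strong induction on \<open>m\<close>, treating row \<open>m\<close> of \<open>U\<close>
  and column \<open>m\<close> of \<open>L\<close> together. Since \<open>L m m = 1\<close>, row
  \<open>m\<close> of the product equation yields \<open>U m j\<close> from earlier rows and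
  columns; column \<open>m\<close> then yields \<open>L i m * U m m\<close>. The pivot
  \<open>U m m = U' m m\<close> is nonzero by \<open>diag\<close> and can be cancelled.\<close>

lemma LU_decomposition_unique:
  fixes M :: "nat \<Rightarrow> nat \<Rightarrow> 'a::field"
  assumes LU: "LU_decomposition M L U" and LU': "LU_decomposition M L' U'"
    and diag: "\<And>i. i \<ge> 1 \<Longrightarrow> U' i i \<noteq> 0"
  shows "imat_eq L L' \<and> imat_eq U U'"
proof -
  have main: "m \<ge> 1 \<Longrightarrow> (\<forall>j\<ge>1. U m j = U' m j) \<and> (\<forall>i\<ge>1. L i m = L' i m)" for m
  proof (induction m rule: less_induct)
    case (less m)
    have split: "(\<Sum>k=Suc 0..m. h k) = (\<Sum>k=Suc 0..<m. h k) + h m" for h :: "nat \<Rightarrow> 'a"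
      using less.prems by (cases m) (simp_all add: atLeastLessThanSuc_atLeastAtMost)
    have row: "V m j = M m j - (\<Sum>k=1..<m. K m k * V k j)"
      if "LU_decomposition M K V" "j \<ge> 1" for K V j
    proof -
      have "M m j = (K \<odot> V) m j" and 1: "K m m = 1" and 0: "\<And>k. m < k \<Longrightarrow> K m k = 0"
        using that less.prems
        by (auto simp: LU_decomposition_def unit_lower_triangular_def imat_eq_def)
      with imat_mult_lower[of m K V j, OF 0] show ?thesis by (simp add: split 1)
    qed
    have U: "U m j = U' m j" if "j \<ge> 1" for j
      unfolding row[OF LU that] row[OF LU' that] using less.IH that less.prems by simp
    have col: "K i m * V m m = M i m - (\<Sum>k=1..<m. K i k * V k m)"
      if "LU_decomposition M K V" "i \<ge> 1" for K V i
    proof -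
      have "M i m = (K \<odot> V) i m" and 0: "\<And>k. m < k \<Longrightarrow> V k m = 0"
        using that less.prems
        by (auto simp: LU_decomposition_def upper_triangular_imat_def imat_eq_def)
      with imat_mult_upper[of m V K i, OF 0] show ?thesis by (simp add: split)
    qed
    have "L i m = L' i m" if "i \<ge> 1" for i
    proof -
      have "L i m * U m m = L' i m * U' m m"
        unfolding col[OF LU that] col[OF LU' that] using less.IH that less.prems by simp
      then show ?thesis using U[OF less.prems] diag[OF less.prems] by simp
    qed
    with U show ?case by blast
  qed
  then show ?thesis by (simp add: imat_eq_def)
qed

section \<open>Stirling numbers and rising factorials\<close>

text \<open>Induction on \<open>n\<close>: the relation \<open>x * pochhammer x k = pochhammer x
  (Suc k) - of_nat k * pochhammer x k\<close> matches the recurrence of the Stirling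
  numbers.\<close>

lemma power_eq_sum_Stirling_pochhammer:
  fixes x :: "'a::comm_ring_1"
  shows "x ^ n = (\<Sum>k\<le>n. (- 1) ^ (n + k) * of_nat (Stirling n k) * pochhammer x k)"
proof (induction n)
  case (Suc n)
  \<comment> \<open>An index shift by one, which flips the sign. The boundary terms vanish: at 0
    because of the factor \<open>k\<close>, at \<open>Suc n\<close> because
    \<open>Stirling n (Suc n) = 0\<close>.\<close>
  have shift: "(\<Sum>k\<le>n. (- 1) ^ (n + k) * of_nat (Suc k * Stirling n (Suc k)) * pochhammer x (Suc k))
     = - (\<Sum>k\<le>n. (- 1) ^ (n + k) * of_nat (k * Stirling n k) * pochhammer x k)"
    (is "?l = - ?r")
  proof -
    have "- ?r = (\<Sum>k\<le>Suc n. - ((- 1) ^ (n + k) * of_nat (k * Stirling n k) * pochhammer x k))"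
      by (simp add: sum_negf)
    also have "\<dots> = ?l"
      by (subst sum.atMost_Suc_shift) simp
    finally show ?thesis by simp
  qed
  have "(\<Sum>k\<le>Suc n. (- 1) ^ (Suc n + k) * of_nat (Stirling (Suc n) k) * pochhammer x k)
     = (\<Sum>k\<le>n. (- 1) ^ (n + k) * of_nat (Suc k * Stirling n (Suc k) + Stirling n k) * pochhammer x (Suc k))"
    by (subst sum.atMost_Suc_shift) (simp del: of_nat_Suc of_nat_add)
  also have "\<dots> = ?l + (\<Sum>k\<le>n. (- 1) ^ (n + k) * of_nat (Stirling n k) * pochhammer x (Suc k))"
    unfolding sum.distrib[symmetric] by (intro sum.cong refl) (simp add: algebra_simps)
  also have "\<dots> = (\<Sum>k\<le>n. (- 1) ^ (n + k) * of_nat (Stirling n k) * (pochhammer x (Suc k) - of_nat k * pochhammer x k))"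
    unfolding shift by (simp add: sum_subtractf algebra_simps)
  also have "\<dots> = (\<Sum>k\<le>n. x * ((- 1) ^ (n + k) * of_nat (Stirling n k) * pochhammer x k))"
    by (intro sum.cong refl) (simp add: pochhammer_rec' algebra_simps)
  also have "\<dots> = x ^ Suc n"
    by (simp add: Suc sum_distrib_left)
  finally show ?case by simp
qed simp

text \<open>One factor \<open>x\<close> is cancelled from the expansion of \<open>x ^ n\<close>. The
  term \<open>k = 0\<close> vanishes for \<open>n \<ge> 1\<close>, and every other rising factorial
  starts with the factor \<open>x\<close>.\<close>

lemma power_eq_sum_Stirling_pochhammer':
  fixes x :: "'a::idom"
  assumes "x \<noteq> 0" "n \<ge> 1"
  shows "(\<Sum>k=1..n. (- 1) ^ (k + n) * of_nat (Stirling n k) * pochhammer (x + 1) (k - 1)) = x ^ (n - 1)"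
proof -
  obtain n' where n: "n = Suc n'" using assms by (cases n) auto
  have "x * x ^ (n - 1) = (\<Sum>k=0..n. (- 1) ^ (k + n) * of_nat (Stirling n k) * pochhammer x k)"
    using power_eq_sum_Stirling_pochhammer[of x n] by (simp add: n atLeast0AtMost add_ac)
  also have "\<dots> = (\<Sum>k=1..n. (- 1) ^ (k + n) * of_nat (Stirling n k) * pochhammer x k)"
    by (rule sum.mono_neutral_right) (auto simp: n not_less_eq_eq)
  also have "\<dots> = (\<Sum>k=1..n. x * ((- 1) ^ (k + n) * of_nat (Stirling n k) * pochhammer (x + 1) (k - 1)))"
  proof (intro sum.cong refl)
    fix k assume "k \<in> {1..n}"
    then obtain k' where "k = Suc k'" by (cases k) auto
    then show "(- 1) ^ (k + n) * of_nat (Stirling n k) * pochhammer x k =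
      x * ((- 1) ^ (k + n) * of_nat (Stirling n k) * pochhammer (x + 1) (k - 1))"
      by (simp add: pochhammer_rec)
  qed
  finally show ?thesis using assms(1) by (simp flip: sum_distrib_left)
qed

lemma fact_binomial_eq_pochhammer:
  "fact k * of_nat ((n + k) choose k) = (pochhammer (of_nat n + 1) k :: 'a::field_char_0)"
  by (simp add: binomial_gbinomial gbinomial_pochhammer' add_ac)

lemma fact_binomial_eq_pochhammer_minus:
  "fact k * of_nat (n choose k) = ((- 1) ^ k * pochhammer (- of_nat n) k :: 'a::field_char_0)"
  by (simp add: binomial_gbinomial gbinomial_pochhammer)

text \<open>The preceding expansion at \<open>x = i\<close>: the binomial coefficient times
  \<open>fact (k - 1)\<close> is the rising factorial of \<open>i + 1\<close>. The weights to the
  right of the binomial are those contributed by F and \<Sigma>.\<close>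

lemma sum_Stirling_binomial_shifted:
  assumes "i \<ge> 1" "j \<ge> 1"
  shows "(\<Sum>k=1..j. of_nat ((i + k - 1) choose (k - 1)) * (fact (k - 1) * ((- 1) ^ (k + j) * of_nat (Stirling j k))))
     = (of_nat i ^ (j - 1) :: 'a::field_char_0)" (is "?l = _")
proof -
  have "of_nat ((i + k - 1) choose (k - 1)) * (fact (k - 1) * ((- 1) ^ (k + j) * of_nat (Stirling j k)))
    = (- 1) ^ (k + j) * of_nat (Stirling j k) * (pochhammer (of_nat i + 1) (k - 1) :: 'a)"
    if "k \<in> {1..j}" for k
    using that by (simp flip: fact_binomial_eq_pochhammer)
  then have "?l = (\<Sum>k=1..j. (- 1) ^ (k + j) * of_nat (Stirling j k) * pochhammer (of_nat i + 1) (k - 1))"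
    by (intro sum.cong refl)
  then show ?thesis
    using power_eq_sum_Stirling_pochhammer'[of "of_nat i :: 'a" j] assms by simp
qed

text \<open>The same expansion at \<open>x = - i\<close>, where the rising factorial of
  \<open>1 - i\<close> is a signed falling factorial of \<open>i - 1\<close>.\<close>

lemma sum_Stirling_binomial_alternating:
  assumes "i \<ge> 1" "j \<ge> 1"
  shows "(\<Sum>k=1..j. (- 1) ^ k * of_nat ((i - 1) choose (k - 1)) * (fact (k - 1) * ((- 1) ^ (k + j) * of_nat (Stirling j k))))
     = ((- 1) ^ j * of_nat i ^ (j - 1) :: 'a::field_char_0)" (is "?l = _")
proof -
  obtain i' where i: "i = Suc i'" using assms by (cases i) auto
  have "(- 1) ^ k * of_nat ((i - 1) choose (k - 1)) * (fact (k - 1) * ((- 1) ^ (k + j) * of_nat (Stirling j k)))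
    = - ((- 1) ^ (k + j) * of_nat (Stirling j k) * (pochhammer (- of_nat i + 1) (k - 1) :: 'a))"
    if k1: "k \<in> {1..j}" for k
  proof -
    obtain k' where k: "k = Suc k'" using k1 by (cases k) auto
    have "(- 1) ^ k * of_nat ((i - 1) choose (k - 1)) * (fact (k - 1) * ((- 1) ^ (k + j) * of_nat (Stirling j k)))
      = (- 1) ^ (k + j) * of_nat (Stirling j k) * ((- 1) ^ k * (fact k' * of_nat (i' choose k') :: 'a))"
      by (simp add: k i mult_ac)
    then show ?thesis
      unfolding fact_binomial_eq_pochhammer_minus by (simp add: k i flip: power_add)
  qed
  then have "?l = (\<Sum>k=1..j. - ((- 1) ^ (k + j) * of_nat (Stirling j k) * pochhammer (- of_nat i + 1) (k - 1)))"
    by (intro sum.cong refl)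
  moreover have "- ((- of_nat i) ^ (j - 1)) = ((- 1) ^ j * of_nat i ^ (j - 1) :: 'a)"
    using assms by (cases j) (simp_all add: power_minus[of "of_nat i"] flip: of_nat_Suc)
  ultimately show ?thesis
    using power_eq_sum_Stirling_pochhammer'[of "- of_nat i :: 'a" j] assms by (simp add: sum_negf)
qed

section \<open>The Girard-Waring formula\<close>

text \<open>The value at \<open>n = s = 0\<close> makes the formula for \<open>a\<^sup>n + b\<^sup>n\<close> hold for \<open>n = 0\<close> as well; the
  closed form \<open>n (n - s - 1)! / (s! (n - 2s)!)\<close> is valid only for \<open>n \<ge> 1\<close>.\<close>

fun waring_coeff :: "nat \<Rightarrow> nat \<Rightarrow> nat" where
  "waring_coeff 0 s = (if s = 0 then 2 else 0)"
| "waring_coeff (Suc 0) s = (if s = 0 then 1 else 0)"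
| "waring_coeff (Suc (Suc n)) 0 = 1"
| "waring_coeff (Suc (Suc n)) (Suc s) = waring_coeff (Suc n) (Suc s) + waring_coeff n s"

lemma waring_coeff_eq_0: "n < 2 * s \<Longrightarrow> waring_coeff n s = 0"
  by (induction n s rule: waring_coeff.induct) auto

lemma waring_coeff_0_right: "n \<ge> 1 \<Longrightarrow> waring_coeff n 0 = 1"
  by (cases "(n, 0::nat)" rule: waring_coeff.cases) auto

lemma waring_coeff_closed_form:
  "n \<ge> 1 \<Longrightarrow> 2 * s \<le> n \<Longrightarrow> waring_coeff n s * (fact s * fact (n - 2 * s)) = n * fact (n - s - 1)"
proof (induction n s rule: waring_coeff.induct)
  case (2 s)
  then have "s = 0" by simp
  then show ?case by simp
next
  case (4 n s)
  show ?case
  proof (cases "2 * s = n")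
    case True
    \<comment> \<open>Here \<open>waring_coeff (Suc n) (Suc s)\<close> vanishes, so only
      \<open>waring_coeff n s\<close> is left. For \<open>s = 0\<close> also \<open>n = 0\<close>,
      where the closed form fails and the value 2 comes from the definition.\<close>
    have "waring_coeff n s * fact (Suc s) = (n + 2) * fact s"
    proof (cases s)
      case 0
      with True show ?thesis by simp
    next
      case (Suc s')
      then have "waring_coeff n s * fact s = n * fact (s - 1)" using 4 True by auto
      also have "\<dots> = 2 * fact s" using True Suc by (auto simp: algebra_simps)
      finally have "waring_coeff n s = 2" by simp
      with True show ?thesis by (auto simp: algebra_simps)
    qed
    with True show ?thesis by (auto simp: waring_coeff_eq_0)
  next
    case False
    define r where "r = n - 2 * s - 1"
    with False 4 have n: "n = 2 * s + r + 1" by auto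
    have 1: "waring_coeff (Suc n) (Suc s) * (fact (Suc s) * fact r) = (n + 1) * fact (s + r)"
      and 2: "waring_coeff n s * (fact s * fact (Suc r)) = n * fact (s + r)"
      using 4 by (simp_all add: n)
    have "waring_coeff (Suc (Suc n)) (Suc s) * (fact (Suc s) * fact (Suc r))
        = Suc r * (waring_coeff (Suc n) (Suc s) * (fact (Suc s) * fact r))
          + Suc s * (waring_coeff n s * (fact s * fact (Suc r)))"
      by (simp add: algebra_simps)
    \<comment> \<open>This rests on (r+1)(n+1) + (s+1)n = (n+2)(s+r+1), valid because n =
      2s+r+1.\<close>
    also have "\<dots> = Suc (Suc n) * fact (Suc s + r)"
      unfolding 1 2 by (simp add: n algebra_simps)
    finally show ?thesis by (simp add: n)
  qed
qed auto

text \<open>Write p(n) for the power sum. Then p(n+2) = (a+b) p(n+1) - ab p(n), and the recurrence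
  of \<open>waring_coeff\<close> is this relation read off coefficientwise.\<close>

lemma Girard_Waring:
  fixes a b :: "'a::comm_ring_1"
  shows "a ^ n + b ^ n = (\<Sum>s\<le>n. of_nat (waring_coeff n s) * (a + b) ^ (n - 2 * s) * (- (a * b)) ^ s)"
proof (induction n rule: induct_nat_012)
  case (ge2 n)
  let ?t = "\<lambda>n s. of_nat (waring_coeff n s) * (a + b) ^ (n - 2 * s) * (- (a * b)) ^ s"
  have t_0: "?t n s = 0" if "n < 2 * s" for n s
    using that by (simp add: waring_coeff_eq_0)
  have "(\<Sum>s\<le>Suc (Suc n). ?t (Suc (Suc n)) s)
      = ?t (Suc (Suc n)) 0 + (\<Sum>s\<le>n. ?t (Suc (Suc n)) (Suc s))"
    by (subst sum.atMost_Suc_shift) (use t_0[of "Suc (Suc n)" "Suc (Suc n)"] in simp)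
  also have "(\<Sum>s\<le>n. ?t (Suc (Suc n)) (Suc s))
      = (\<Sum>s\<le>n. (a + b) * ?t (Suc n) (Suc s) + - (a * b) * ?t n s)"
  proof (intro sum.cong refl)
    fix s
    \<comment> \<open>The cases separate where the subtraction in the exponents truncates. At
      \<open>n = 2 * s\<close> the exponent in \<open>?t (Suc n) (Suc s)\<close> truncates, but its
      coefficient is 0.\<close>
    consider "n < 2 * s" | "n = 2 * s" | m where "n = Suc (2 * s + m)"
      by (metis add_Suc_right less_imp_Suc_add linorder_neqE_nat)
    then show "?t (Suc (Suc n)) (Suc s) = (a + b) * ?t (Suc n) (Suc s) + - (a * b) * ?t n s"
      by cases (simp_all add: waring_coeff_eq_0 algebra_simps)
  qed
  also have "\<dots> = (a + b) * (\<Sum>s\<le>n. ?t (Suc n) (Suc s)) + - (a * b) * (\<Sum>s\<le>n. ?t n s)"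
    by (simp only: sum.distrib sum_distrib_left)
  also have "(\<Sum>s\<le>n. ?t (Suc n) (Suc s)) = a ^ Suc n + b ^ Suc n - ?t (Suc n) 0"
    unfolding ge2(2) by (subst sum.atMost_Suc_shift) simp
  also have "(\<Sum>s\<le>n. ?t n s) = a ^ n + b ^ n"
    by (rule ge2(1)[symmetric])
  finally show ?case
    by (simp add: waring_coeff_0_right algebra_simps)
qed auto

section \<open>Jacobi polynomials at negative integer parameters\<close>

text \<open>The factors are the negatives of N, N-1, ..., N-k+1, a signed falling factorial; for
  \<open>k > N\<close> both sides are 0.\<close>

lemma prod_of_nat_diff_Suc:
  "(\<Prod>l=1..k. of_nat l - of_nat (Suc N)) = ((- 1) ^ k * fact k * of_nat (N choose k) :: 'a::field_char_0)"
proof (induction k)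
  case (Suc k)
  have eq: "of_nat (Suc k) * of_nat (N choose Suc k) = ((of_nat N - of_nat k) * of_nat (N choose k) :: 'a)"
  proof (cases "k \<le> N")
    case True
    have "of_nat (Suc k * (N choose Suc k)) = (of_nat ((N - k) * (N choose k)) :: 'a)"
      by (metis binomial_absorb_comp binomial_absorption mult.commute)
    with True show ?thesis by (simp only: of_nat_mult of_nat_diff)
  qed (simp add: binomial_eq_0)
  have "(\<Prod>l=1..Suc k. of_nat l - of_nat (Suc N))
      = (- 1) ^ Suc k * fact k * ((of_nat N - of_nat k) * of_nat (N choose k) :: 'a)"
    using Suc by (simp add: algebra_simps)
  also have "\<dots> = (- 1) ^ Suc k * fact (Suc k) * of_nat (N choose Suc k)"
    unfolding eq[symmetric] by (simp add: algebra_simps)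
  finally show ?case .
qed simp

text \<open>Both products in the Jacobi coefficient become signed falling factorials, with top
  \<open>N\<close> and \<open>a - k - 1\<close>. Their signs combine to \<open>(- 1) ^ n\<close>,
  and their factorials cancel against \<open>fact n\<close> and \<open>n choose k\<close>.\<close>

lemma jacobi_p_negative:
  assumes sum: "of_nat n + \<alpha> + \<beta> = - of_nat (Suc N)" and \<alpha>: "\<alpha> = - of_nat a" and "n < a"
  shows "jacobi_p n \<alpha> \<beta> = ((- 1) ^ n * (\<Sum>k\<le>n. of_nat ((N choose k) * ((a - k - 1) choose (n - k))) * (xvar - 1) ^ (n - k))
     :: 'k::field_char_0 poly fract)"
proof -
  have coeff: "1 / fact n * (of_nat (n choose k) * of_rat (\<Prod>l=1..k. of_nat n + \<alpha> + \<beta> + of_nat l)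
        * of_rat (\<Prod>l=k+1..n. \<alpha> + of_nat l))
      = ((- 1) ^ n * of_nat ((N choose k) * ((a - k - 1) choose (n - k))) :: 'k)"
    if "k \<le> n" for k
  proof -
    have 1: "(\<Prod>l=1..k. of_nat n + \<alpha> + \<beta> + of_nat l) = (- 1) ^ k * fact k * of_nat (N choose k)"
      unfolding sum prod_of_nat_diff_Suc[symmetric] by (intro prod.cong) auto
    have "(\<Prod>l=k+1..n. \<alpha> + of_nat l) = (\<Prod>l=1..n-k. \<alpha> + of_nat (l + k))"
      using that by (intro prod.reindex_bij_witness[of _ "\<lambda>l. l + k" "\<lambda>l. l - k"]) auto
    \<comment> \<open>Since \<open>k \<le> n < a\<close>, the number \<open>a - k - 1\<close> is an
      honest difference, and \<alpha> + l + k = l - (a - k).\<close>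
    also have "\<dots> = (\<Prod>l=1..n-k. of_nat l - of_nat (Suc (a - k - 1)))"
      using that \<open>n < a\<close> by (intro prod.cong refl) (simp add: \<alpha> of_nat_diff flip: of_nat_Suc)
    finally have 2: "(\<Prod>l=k+1..n. \<alpha> + of_nat l) = (- 1) ^ (n - k) * fact (n - k) * of_nat ((a - k - 1) choose (n - k))"
      by (simp only: prod_of_nat_diff_Suc)
    have of_rat: "of_rat ((- 1) ^ l * fact l * of_nat z) = ((- 1) ^ l * fact l * of_nat z :: 'k)" for l z
      by (metis of_rat_mult of_rat_power of_rat_neg_one of_rat_of_nat_eq of_nat_fact)
    have "fact n = (fact k * fact (n - k) * of_nat (n choose k) :: 'k)"
      using that by (metis binomial_fact_lemma of_nat_fact of_nat_mult)
    moreover have "(- 1 :: 'k) ^ n = (- 1) ^ k * (- 1) ^ (n - k)"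
      using that by (simp flip: power_add)
    moreover have "of_nat (n choose k) \<noteq> (0 :: 'k)" using that by simp
    moreover have "1 / (f * g * c) * (c * (s * f * y) * (t * g * z)) = s * t * (y * z)"
      if "f \<noteq> 0" "g \<noteq> 0" "c \<noteq> 0" for f g c s t y z :: 'k
      using that by (simp add: field_simps)
    ultimately show ?thesis
      unfolding 1 2 of_rat by simp
  qed
  have smult_sum: "smult c (sum f A) = (\<Sum>z\<in>A. smult c (f z))" for c and f :: "nat \<Rightarrow> 'k poly" and A
    by (induction A rule: infinite_finite_induct) (simp_all add: smult_add_right)
  have "smult (1 / fact n) (\<Sum>k=0..n. smult (of_nat (n choose k)
          * of_rat (\<Prod>l=1..k. of_nat n + \<alpha> + \<beta> + of_nat l)
          * of_rat (\<Prod>l=k+1..n. \<alpha> + of_nat l)) ([:- 1, 1:] ^ (n - k)))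
     = (\<Sum>k\<le>n. smult ((- 1) ^ n * of_nat ((N choose k) * ((a - k - 1) choose (n - k)))) ([:- 1, 1 :: 'k:] ^ (n - k)))"
    unfolding smult_sum atLeast0AtMost smult_smult
    by (intro sum.cong refl arg_cong2[where f = smult] coeff) simp
  also have "\<dots> = (- 1) ^ n * (\<Sum>k\<le>n. of_nat ((N choose k) * ((a - k - 1) choose (n - k))) * [:- 1, 1 :: 'k:] ^ (n - k))"
  proof -
    have sm: "smult ((- 1) ^ n * of_nat z) p = (- 1) ^ n * (of_nat z * p)" for z and p :: "'k poly"
    proof (cases "even n")
      case False
      then show ?thesis by (simp add: of_nat_poly)
    qed (simp add: of_nat_poly)
    show ?thesis unfolding sm sum_distrib_left ..
  qed
  finally have poly: "jacobi_p n \<alpha> \<beta> = to_fract \<dots>"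
    unfolding jacobi_p_polynomial by (rule arg_cong)
  have X1: "to_fract [:- 1, 1:] = (xvar - 1 :: 'k poly fract)"
    unfolding xvar_def by (simp flip: to_fract_1 to_fract_diff add: one_pCons)
  have pow: "to_fract (p ^ m) = to_fract p ^ m" for p :: "'k poly" and m
    by (induction m) simp_all
  have nat: "to_fract (of_nat z) = (of_nat z :: 'k poly fract)" for z
    by (induction z) simp_all
  show ?thesis
    unfolding poly to_fract_mult to_fract_sum pow nat X1 by simp
qed

section \<open>Power series coefficients\<close>

lemma inverse_one_minus_power_nth:
  assumes "n \<ge> 1"
  shows "(inverse (1 - fps_const c * fps_X) ^ n) $ k = of_nat ((n + k - 1) choose k) * (c :: 'a::field_char_0) ^ k"
  using one_minus_const_fps_X_neg_power'[of n c] assms by (simp add: fps_inverse_power)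

text \<open>With \<open>u = (x - 1) t / (1 - t)\<close> one has \<open>1 - x t = (1 - t) (1 - u)\<close>.\<close>

lemma Bell_power_nth:
  fixes x :: "'a::field_char_0"
  assumes "j \<ge> 1"
  shows "((inverse (1 - fps_const x * fps_X) * inverse (1 - fps_X)) ^ j) $ n =
    (\<Sum>m\<le>n. of_nat (((2 * j + n - 1) choose (n - m)) * ((j + m - 1) choose m)) * (x - 1) ^ m)"
proof -
  define A where "A = 1 - fps_const x * fps_X"
  define G where "G = inverse (1 - fps_X :: 'a fps)"
  define u where "u = fps_const (x - 1) * (fps_X * G)"
  have iA: "A * inverse A = 1" unfolding A_def by (rule inverse_mult_eq_1') simp
  have G: "(1 - fps_X) * G = 1" unfolding G_def by (rule inverse_mult_eq_1') simp
  have u0: "u $ 0 = 0" by (simp add: u_def)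
  have u1: "1 - u = G * A"
  proof -
    have "G * A = (1 - fps_X) * G - u"
      by (simp add: u_def A_def algebra_simps flip: fps_const_sub)
    then show ?thesis by (simp add: G)
  qed
  \<comment> \<open>Substituting \<open>u\<close> into \<open>G * (1 - fps_X) = 1\<close> shows that
    \<open>G oo u\<close> is the inverse of \<open>1 - u = G * A\<close>, whence
    \<open>inverse A = (G oo u) * G\<close>.\<close>
  have "(G oo u) * (1 - u) = (G * (1 - fps_X)) oo u"
    by (simp add: fps_compose_mult_distrib[OF u0] fps_compose_sub_distrib fps_X_fps_compose_startby0[OF u0])
  also have "\<dots> = 1" using G by (simp add: mult.commute)
  finally have "(G oo u) * G * A = 1" unfolding u1 by (simp add: mult.assoc)
  then have "inverse A = (G oo u) * G"
    using iA by (metis mult.assoc mult.left_neutral mult.right_neutral)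
  then have "(inverse A * G) ^ j = G ^ (2 * j) * (G ^ j oo u)"
    by (simp add: power_mult_distrib fps_compose_power[OF u0] power_mult power2_eq_square mult_ac)
  also have "\<dots> $ n = (\<Sum>k\<le>n. (G ^ (2 * j)) $ k * (\<Sum>m\<le>n-k. (G ^ j) $ m * (u ^ m) $ (n - k)))"
    by (simp add: fps_mult_nth fps_compose_nth atLeast0AtMost)
  \<comment> \<open>As \<open>u ^ m\<close> has no terms below degree \<open>m\<close>, the inner
    range can be made independent of \<open>k\<close>, so that the sums can be swapped.\<close>
  also have "\<dots> = (\<Sum>k\<le>n. (G ^ (2 * j)) $ k * (\<Sum>m\<le>n. (G ^ j) $ m * (u ^ m) $ (n - k)))"
  proof -
    have "(\<Sum>m\<le>n-k. (G ^ j) $ m * (u ^ m) $ (n - k)) = (\<Sum>m\<le>n. (G ^ j) $ m * (u ^ m) $ (n - k))" for k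
      by (rule sum.mono_neutral_left) (use startsby_zero_power_prefix[OF u0] in auto)
    then show ?thesis by simp
  qed
  also have "\<dots> = (\<Sum>m\<le>n. (G ^ j) $ m * (\<Sum>k\<le>n. (G ^ (2 * j)) $ k * (u ^ m) $ (n - k)))"
    unfolding sum_distrib_left by (subst sum.swap) (simp add: mult_ac)
  also have "\<dots> = (\<Sum>m\<le>n. (G ^ j) $ m * (G ^ (2 * j) * u ^ m) $ n)"
    by (simp add: fps_mult_nth atLeast0AtMost)
  also have "\<dots> = (\<Sum>m\<le>n. of_nat (((2 * j + n - 1) choose (n - m)) * ((j + m - 1) choose m)) * (x - 1) ^ m)"
  proof (intro sum.cong refl)
    fix m assume "m \<in> {..n}"
    have G_nth: "(G ^ l) $ k = of_nat ((l + k - 1) choose k)" if "l \<ge> 1" for l k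
      using inverse_one_minus_power_nth[OF that, of "1::'a" k] by (simp add: G_def)
    \<comment> \<open>The powers of \<open>G\<close> merge into \<open>G ^ (2 * j + m)\<close>,
      whose coefficient at \<open>n - m\<close> has upper index \<open>2 * j + n - 1\<close>, free
      of \<open>m\<close>.\<close>
    have "G ^ (2 * j) * u ^ m = fps_const ((x - 1) ^ m) * (fps_X ^ m * G ^ (2 * j + m))"
      by (simp add: u_def power_mult_distrib power_add fps_const_power mult_ac)
    then have "(G ^ (2 * j) * u ^ m) $ n = (x - 1) ^ m * of_nat ((2 * j + n - 1) choose (n - m))"
      using \<open>m \<in> {..n}\<close> assms G_nth[of "2 * j + m" "n - m"] by (simp add: fps_X_power_mult_nth)
    then show "(G ^ j) $ m * (G ^ (2 * j) * u ^ m) $ n =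
       of_nat (((2 * j + n - 1) choose (n - m)) * ((j + m - 1) choose m)) * (x - 1) ^ m"
      using G_nth[OF assms] by (simp add: mult_ac)
  qed
  finally show ?thesis by (simp add: A_def G_def)
qed

section \<open>Entries of U0 and L0 as coefficients\<close>

text \<open>In the Girard-Waring formula, term \<open>s\<close> is a multiple of
  \<open>(y * g + 1) ^ (n - 2 * s) * g ^ s\<close>. Its binomial expansion reaches exactly the
  powers of \<open>g\<close> from \<open>s\<close> to \<open>n - s\<close>; collecting by
  \<open>k\<close> bounds \<open>s\<close> by \<open>min k (n - k)\<close>.\<close>

lemma power_sum_as_power_series:
  fixes a b g y :: "'a::comm_ring_1"
  assumes sum: "a + b = y * g + 1" and prod: "a * b = - g"
  shows "a ^ n + b ^ n = (\<Sum>k\<le>n. (\<Sum>s\<le>min k (n - k).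
           of_nat (waring_coeff n s * ((n - 2 * s) choose (k - s))) * y ^ (k - s)) * g ^ k)"
proof -
  define h where "h s k = of_nat (waring_coeff n s * ((n - 2 * s) choose (k - s))) * y ^ (k - s) * g ^ k" for s k
  have inner: "of_nat (waring_coeff n s) * (y * g + 1) ^ (n - 2 * s) * g ^ s
      = (\<Sum>k\<le>n. if k \<in> {s..n-s} then h s k else 0)" if "s \<le> n" for s
  proof (cases "2 * s \<le> n")
    case True
    have "of_nat (waring_coeff n s) * (y * g + 1) ^ (n - 2 * s) * g ^ s = (\<Sum>q\<le>n-2*s. h s (q + s))"
      unfolding binomial_ring sum_distrib_left sum_distrib_right
      by (intro sum.cong refl) (simp add: h_def power_mult_distrib power_add mult_ac)
    also have "\<dots> = (\<Sum>k\<in>{s..n-s}. h s k)"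
      by (rule sum.reindex_bij_witness[of _ "\<lambda>k. k - s" "\<lambda>q. q + s"]) (use True in auto)
    also have "{s..n-s} = {..n} \<inter> {s..n-s}" by auto
    also have "sum (h s) \<dots> = (\<Sum>k\<le>n. if k \<in> {s..n-s} then h s k else 0)"
      by (rule sum.inter_restrict) simp
    finally show ?thesis .
  next
    case False
    then show ?thesis by (simp add: waring_coeff_eq_0 h_def)
  qed
  have "a ^ n + b ^ n = (\<Sum>s\<le>n. \<Sum>k\<le>n. if k \<in> {s..n-s} then h s k else 0)"
    unfolding Girard_Waring sum prod minus_minus by (intro sum.cong refl inner) simp
  also have "\<dots> = (\<Sum>k\<le>n. \<Sum>s\<le>n. if k \<in> {s..n-s} then h s k else 0)"
    by (rule sum.swap)
  also have "\<dots> = (\<Sum>k\<le>n. \<Sum>s\<le>min k (n - k). h s k)"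
  proof (rule sum.cong[OF refl])
    fix k assume "k \<in> {..n}"
    then have "{..min k (n - k)} = {..n} \<inter> {..min k (n - k)}" by auto
    then have "(\<Sum>s\<le>min k (n - k). h s k) = (\<Sum>s\<le>n. if s \<in> {..min k (n - k)} then h s k else 0)"
      by (metis (no_types) finite_atMost sum.inter_restrict)
    also have "\<dots> = (\<Sum>s\<le>n. if k \<in> {s..n-s} then h s k else 0)"
      using \<open>k \<in> {..n}\<close> by (intro sum.cong refl) auto
    finally show "(\<Sum>s\<le>n. if k \<in> {s..n-s} then h s k else 0) = (\<Sum>s\<le>min k (n - k). h s k)" ..
  qed
  finally show ?thesis by (simp add: h_def sum_distrib_right)
qed

text \<open>Put q = k-s and r = j-k-s. By the closed form of \<open>waring_coeff\<close>, both sides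
  equal j k (j-s-1)! / (s! q! r!). This matches Jacobi coefficients with Girard-Waring
  coefficients.\<close>

lemma waring_coeff_binomial:
  assumes "k \<ge> 1" "s \<le> k" "k + s \<le> j"
  shows "j * ((k choose s) * ((j - s - 1) choose (j - k - s))) = k * (waring_coeff j s * ((j - 2 * s) choose (k - s)))"
proof -
  define q r where "q = k - s" and "r = j - k - s"
  have k: "k = s + q" and j: "j = 2 * s + q + r" using assms by (auto simp: q_def r_def)
  have 1: "fact s * fact q * (k choose s) = fact k"
    using binomial_fact_lemma[of s k] by (simp add: k)
  have 2: "fact r * fact (k - 1) * ((j - s - 1) choose r) = fact (j - s - 1)"
    using binomial_fact_lemma[of r "j - s - 1"] assms by (simp add: k j)
  have 3: "waring_coeff j s * (fact s * fact (q + r)) = j * fact (j - s - 1)"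
    using waring_coeff_closed_form[of j s] assms by (simp add: k j)
  have 4: "fact q * fact r * ((q + r) choose q) = fact (q + r)"
    using binomial_fact_lemma[of q "q + r"] by simp
  have 5: "fact k = k * fact (k - 1)"
    using assms by (simp add: fact_reduce)
  have "(fact s * fact q * fact r * fact (k - 1)) * (j * ((k choose s) * ((j - s - 1) choose r)))
      = j * (fact s * fact q * (k choose s)) * (fact r * fact (k - 1) * ((j - s - 1) choose r))"
    by (simp add: mult_ac)
  also have "\<dots> = k * fact (k - 1) * (waring_coeff j s * (fact s * fact (q + r)))"
    unfolding 1 2 3 5 by (simp add: mult_ac)
  also have "\<dots> = (fact s * fact q * fact r * fact (k - 1)) * (k * (waring_coeff j s * ((q + r) choose q)))"
    unfolding 4[symmetric] by (simp add: mult_ac)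
  finally have "j * ((k choose s) * ((j - s - 1) choose r)) = k * (waring_coeff j s * ((q + r) choose q))"
    by simp
  moreover have "j - k - s = r" "j - 2 * s = q + r" "k - s = q" by (simp_all add: k j)
  ultimately show ?thesis by simp
qed

text \<open>\<open>jacobi_p_negative\<close> applies with \<open>n = j - k\<close>,
  \<open>a = j\<close> and \<open>N = k\<close>; its sign cancels the one in \<open>U0_mat\<close>.
  The result is the coefficient of \<open>g ^ k\<close> in \<open>power_sum_as_power_series\<close>
  for \<open>y = xvar - 1\<close>.\<close>

lemma U0_mat_eq:
  assumes "k \<ge> 1" "k \<le> j"
  shows "(U0_mat k j :: 'k::field_char_0 poly fract) =
    (\<Sum>s\<le>min k (j - k). of_nat (waring_coeff j s * ((j - 2 * s) choose (k - s))) * (xvar - 1) ^ (k - s))"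
proof -
  let ?y = "xvar - 1 :: 'k poly fract"
  have p: "jacobi_p (j - k) (- of_nat j) (- 1) = ((- 1) ^ (j - k) *
      (\<Sum>s\<le>j-k. of_nat ((k choose s) * ((j - s - 1) choose (j - k - s))) * ?y ^ (j - k - s)))"
    using assms by (intro jacobi_p_negative) (auto simp: of_nat_diff)
  have sign: "(- 1) powi (int k - int j) = ((- 1) ^ (j - k) :: 'k poly fract)"
  proof -
    have "int k - int j = - int (j - k)" using assms by simp
    then show ?thesis by (simp only: power_int_minus power_int_of_nat) (simp flip: power_inverse)
  qed
  have "U0_mat k j = (of_nat j / of_nat k) * ?y powi (2 * int k - int j) *
      (\<Sum>s\<le>j-k. of_nat ((k choose s) * ((j - s - 1) choose (j - k - s))) * ?y ^ (j - k - s))"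
  proof -
    have "e * c * d * (e * S) = c * d * S" if "e * e = 1" for e c d S :: "'k poly fract"
      using that by (metis (no_types, opaque_lifting) mult.assoc mult.commute mult.right_neutral)
    from this[of "(- 1) ^ (j - k)"] show ?thesis
      using assms by (simp add: U0_mat_def p sign flip: power_mult_distrib)
  qed
  also have "\<dots> = (\<Sum>s\<le>j-k. (of_nat j / of_nat k) * of_nat ((k choose s) * ((j - s - 1) choose (j - k - s))) *
      (?y powi (2 * int k - int j) * ?y ^ (j - k - s)))"
    by (simp add: sum_distrib_left mult_ac)
  also have "\<dots> = (\<Sum>s\<le>min k (j - k). (of_nat j / of_nat k) * of_nat ((k choose s) * ((j - s - 1) choose (j - k - s))) *
      (?y powi (2 * int k - int j) * ?y ^ (j - k - s)))"
    by (rule sum.mono_neutral_right) (auto simp: not_le)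
  also have "\<dots> = (\<Sum>s\<le>min k (j - k). of_nat (waring_coeff j s * ((j - 2 * s) choose (k - s))) * ?y ^ (k - s))"
  proof (intro sum.cong refl arg_cong2[where f = "(*)"])
    fix s assume s: "s \<in> {..min k (j - k)}"
    then have "j * ((k choose s) * ((j - s - 1) choose (j - k - s))) =
        k * (waring_coeff j s * ((j - 2 * s) choose (k - s)))"
      using assms by (intro waring_coeff_binomial) auto
    then have "of_nat j * of_nat ((k choose s) * ((j - s - 1) choose (j - k - s)))
      = (of_nat k * of_nat (waring_coeff j s * ((j - 2 * s) choose (k - s))) :: 'k poly fract)"
      by (simp only: of_nat_mult[symmetric])
    then show "(of_nat j / of_nat k) * of_nat ((k choose s) * ((j - s - 1) choose (j - k - s)))
      = (of_nat (waring_coeff j s * ((j - 2 * s) choose (k - s))) :: 'k poly fract)"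
      using assms by (simp add: field_simps del: of_nat_mult)
    \<comment> \<open>The exponent \<open>2 * int k - int j\<close> may be negative, so adding
      exponents relies on \<open>xvar - 1\<close> being nonzero.\<close>
    have "?y powi (2 * int k - int j) * ?y ^ (j - k - s) = ?y powi (2 * int k - int j + int (j - k - s))"
      using xvar_minus_1_nonzero[where 'k = 'k] by (simp only: power_int_add power_int_of_nat simp_thms)
    also have "2 * int k - int j + int (j - k - s) = int (k - s)"
      using s assms by auto
    finally show "?y powi (2 * int k - int j) * ?y ^ (j - k - s) = ?y ^ (k - s)" by simp
  qed
  finally show ?thesis .
qed

text \<open>\<open>jacobi_p_negative\<close> applies with \<open>n = i - j\<close>,
  \<open>a = i\<close> and \<open>N = i + j - 1\<close>; reversing the sum gives the coefficient in
  \<open>Bell_power_nth\<close>. For \<open>i < j\<close> both sides are 0, as the power series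
  starts in degree \<open>j\<close>.\<close>

lemma L0_mat_eq:
  assumes "j \<ge> 1"
  shows "(L0_mat i j :: 'k::field_char_0 poly fract) =
    ((fps_X * (inverse (1 - fps_const xvar * fps_X) * inverse (1 - fps_X))) ^ j) $ i"
proof (cases "j \<le> i")
  case True
  let ?y = "xvar - 1 :: 'k poly fract"
  define n where "n = i - j"
  have i: "i = j + n" using True by (simp add: n_def)
  have "jacobi_p n (- of_nat i) (- of_nat i) = ((- 1) ^ n *
      (\<Sum>k\<le>n. of_nat (((i + j - 1) choose k) * ((i - k - 1) choose (n - k))) * ?y ^ (n - k)))"
    using assms by (intro jacobi_p_negative) (auto simp: i of_nat_diff)
  then have "L0_mat i j = (\<Sum>k\<le>n. of_nat (((i + j - 1) choose k) * ((i - k - 1) choose (n - k))) * ?y ^ (n - k))"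
    using True by (simp add: L0_mat_def flip: n_def power_mult_distrib mult.assoc)
  also have "\<dots> = (\<Sum>m\<le>n. of_nat (((2 * j + n - 1) choose (n - m)) * ((j + m - 1) choose m)) * ?y ^ m)"
    by (rule sum.reindex_bij_witness[of _ "\<lambda>m. n - m" "\<lambda>k. n - k"]) (auto simp: i mult_2 add_ac)
  finally show ?thesis
    using True by (simp add: Bell_power_nth[OF assms] power_mult_distrib[of fps_X] fps_X_power_mult_nth n_def)
next
  case False
  then show ?thesis
    by (simp add: L0_mat_def power_mult_distrib[of fps_X] fps_X_power_mult_nth)
qed

lemma L0_U0_product:
  assumes "i \<ge> 1" "j \<ge> 1"
  shows "(\<Sum>k=1..i. L0_mat i k * U0_mat k j) =
    (xvar ^ i * of_nat ((i + j - 1) choose (j - 1)) + (- 1) ^ j * of_nat ((i - 1) choose (j - 1))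
      :: 'k::field_char_0 poly fract)"
proof -
  let ?x = "xvar :: 'k poly fract"
  define A B where "A = 1 - fps_const ?x * fps_X" and "B = (1 - fps_X :: 'k poly fract fps)"
  define a b where "a = inverse A" and "b = - (fps_X * inverse B)"
  define g where "g = fps_X * (inverse A * inverse B)"
  \<comment> \<open>For \<open>1 \<le> k \<le> j\<close> this is \<open>U0_mat k j\<close>; the
    formula also covers the constant term \<open>k = 0\<close> of the expansion in
    \<open>g\<close>.\<close>
  define V where "V k = (\<Sum>s\<le>min k (j - k). of_nat (waring_coeff j s * ((j - 2 * s) choose (k - s))) * (?x - 1) ^ (k - s))" for k
  have iA: "A * inverse A = 1" unfolding A_def by (rule inverse_mult_eq_1') simp
  have iB: "B * inverse B = 1" unfolding B_def by (rule inverse_mult_eq_1') simp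
  have prod: "a * b = - g" by (simp add: a_def b_def g_def mult_ac)
  have sum: "a + b = fps_const (?x - 1) * g + 1"
  proof -
    \<comment> \<open>Over the common denominator \<open>A * B\<close> the numerator is
      \<open>B - fps_X * A\<close>, that is, (1-t) - t(1-xt) = (x-1)t + (1-xt)(1-t).\<close>
    have "a + b = inverse A * (B * inverse B) - fps_X * (A * inverse A) * inverse B"
      unfolding iA iB by (simp add: a_def b_def)
    also have "\<dots> = (B - fps_X * A) * (inverse A * inverse B)"
      by (simp add: algebra_simps)
    also have "B - fps_X * A = fps_const (?x - 1) * fps_X + A * B"
      by (simp add: A_def B_def algebra_simps flip: fps_const_sub)
    also have "(fps_const (?x - 1) * fps_X + A * B) * (inverse A * inverse B)
       = fps_const (?x - 1) * g + (A * inverse A) * (B * inverse B)"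
      by (simp add: g_def algebra_simps del: fps_const_sub)
    finally show ?thesis by (simp add: iA iB)
  qed
  have of_nat_fps: "(of_nat m :: 'k poly fract fps) = fps_const (of_nat m)" for m
    by (simp add: fps_of_nat)
  have fps_const_sum: "fps_const (sum f S) = (\<Sum>s\<in>S. fps_const (f s))" for f :: "nat \<Rightarrow> 'k poly fract" and S
    by (induction S rule: infinite_finite_induct) (simp_all flip: fps_const_add)
  have "a ^ j + b ^ j = (\<Sum>k\<le>j. fps_const (V k) * g ^ k)"
    unfolding power_sum_as_power_series[OF sum prod] V_def fps_const_sum
    by (simp only: of_nat_fps fps_const_power fps_const_mult)
  then have "(a ^ j + b ^ j) $ i = (\<Sum>k\<le>j. V k * (g ^ k) $ i)"
    by (simp add: fps_sum_nth)
  \<comment> \<open>\<open>g ^ k\<close> starts in degree \<open>k\<close>, which removes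
    \<open>k > i\<close>; the constant \<open>g ^ 0\<close> has no coefficient at
    \<open>i \<ge> 1\<close>.\<close>
  also have "\<dots> = (\<Sum>k=1..min i j. V k * (g ^ k) $ i)"
  proof (rule sum.mono_neutral_right)
    show "\<forall>k\<in>{..j} - {1..min i j}. V k * (g ^ k) $ i = 0"
    proof
      fix k assume "k \<in> {..j} - {1..min i j}"
      then have "k = 0 \<or> i < k" by auto
      then show "V k * (g ^ k) $ i = 0"
        using assms by (auto simp: g_def power_mult_distrib[of fps_X] fps_X_power_mult_nth)
    qed
  qed auto
  also have "\<dots> = (\<Sum>k=1..min i j. L0_mat i k * U0_mat k j)"
    by (intro sum.cong refl) (simp add: L0_mat_eq U0_mat_eq V_def g_def A_def B_def)
  also have "\<dots> = (\<Sum>k=1..i. L0_mat i k * U0_mat k j)"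
    by (rule sum.mono_neutral_left) (auto simp: U0_mat_def)
  finally have "(\<Sum>k=1..i. L0_mat i k * U0_mat k j) = (a ^ j) $ i + (b ^ j) $ i" by simp
  moreover have "(a ^ j) $ i = ?x ^ i * of_nat ((i + j - 1) choose (j - 1))"
    using inverse_one_minus_power_nth[OF assms(2), of ?x i] binomial_symmetric[of i "j + i - 1"] assms
    by (simp add: a_def A_def add_ac)
  moreover have "(b ^ j) $ i = (- 1) ^ j * of_nat ((i - 1) choose (j - 1))"
  proof -
    have "b ^ j = (- 1) ^ j * (fps_X ^ j * inverse B ^ j)"
      by (simp add: b_def power_minus[of "fps_X * _"] power_mult_distrib)
    also have "(- 1) ^ j = fps_const ((- 1) ^ j :: 'k poly fract)"
      by (simp flip: fps_const_power fps_const_neg)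
    finally have "(b ^ j) $ i = (- 1) ^ j * (if i < j then 0 else (inverse B ^ j) $ (i - j))"
      by (simp add: fps_X_power_mult_nth)
    also have "\<dots> = (- 1) ^ j * of_nat ((i - 1) choose (j - 1))"
      using inverse_one_minus_power_nth[OF assms(2), of "1 :: 'k poly fract" "i - j"]
        binomial_symmetric[of "j - 1" "i - 1"] assms
      by (auto simp: B_def binomial_eq_0)
    finally show ?thesis .
  qed
  ultimately show ?thesis by simp
qed

section \<open>Assembling the decomposition\<close>

lemma U0_F_Sigma_eq:
  assumes "j \<ge> 1"
  shows "(U0_mat \<odot> F_mat \<odot> Sigma_mat) i j =
    (\<Sum>k=1..j. U0_mat i k * (fact (k - 1) * ((- 1) ^ (k + j) * of_nat (Stirling j k))) :: 'k::field_char_0 poly fract)"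
proof -
  have F: "(U0_mat \<odot> F_mat) i k = U0_mat i k * (fact (k - 1) :: 'k poly fract)" if "k \<ge> 1" for k
  proof -
    have "(U0_mat \<odot> F_mat) i k = (\<Sum>l=1..k. U0_mat i l * (F_mat l k :: 'k poly fract))"
      by (rule imat_mult_upper) (simp add: F_mat_def)
    also have "\<dots> = (\<Sum>l\<in>{k}. U0_mat i l * F_mat l k)"
      using that by (intro sum.mono_neutral_right) (auto simp: F_mat_def)
    finally show ?thesis by (simp add: F_mat_def)
  qed
  have "(U0_mat \<odot> F_mat \<odot> Sigma_mat) i j = (\<Sum>k=1..j. (U0_mat \<odot> F_mat) i k * (Sigma_mat k j :: 'k poly fract))"
    by (rule imat_mult_upper) (simp add: Sigma_mat_def)
  also have "\<dots> = (\<Sum>k=1..j. U0_mat i k * (fact (k - 1) * ((- 1) ^ (k + j) * of_nat (Stirling j k))))"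
    by (intro sum.cong refl) (simp add: F Sigma_mat_def mult_ac)
  finally show ?thesis .
qed

lemma LU_decomposition_M0:
  "LU_decomposition (M0_mat :: nat \<Rightarrow> nat \<Rightarrow> 'k::field_char_0 poly fract) L0_mat (U0_mat \<odot> F_mat \<odot> Sigma_mat)"
  unfolding LU_decomposition_def
proof (intro conjI)
  show "unit_lower_triangular (L0_mat :: nat \<Rightarrow> nat \<Rightarrow> 'k poly fract)"
    by (simp add: unit_lower_triangular_def L0_mat_def jacobi_p_polynomial flip: one_pCons)
  show "upper_triangular_imat (U0_mat \<odot> F_mat \<odot> Sigma_mat :: nat \<Rightarrow> nat \<Rightarrow> 'k poly fract)"
    by (simp add: upper_triangular_imat_def U0_F_Sigma_eq U0_mat_def)
  show "imat_eq (M0_mat :: nat \<Rightarrow> nat \<Rightarrow> 'k poly fract) (L0_mat \<odot> (U0_mat \<odot> F_mat \<odot> Sigma_mat))"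
    unfolding imat_eq_def
  proof (intro allI impI)
    fix i j :: nat assume i: "i \<ge> 1" and j: "j \<ge> 1"
    define f where "f k = (fact (k - 1) * ((- 1) ^ (k + j) * of_nat (Stirling j k)) :: 'k poly fract)" for k
    have "(L0_mat \<odot> (U0_mat \<odot> F_mat \<odot> Sigma_mat)) i j
        = (\<Sum>m=1..i. L0_mat i m * (U0_mat \<odot> F_mat \<odot> Sigma_mat) m j :: 'k poly fract)"
      by (rule imat_mult_lower) (simp add: L0_mat_def)
    also have "\<dots> = (\<Sum>m=1..i. \<Sum>k=1..j. L0_mat i m * U0_mat m k * f k)"
      by (simp add: U0_F_Sigma_eq[OF j] f_def sum_distrib_left mult.assoc)
    \<comment> \<open>Summing over \<open>m\<close> first isolates the entries of the product of
      \<open>L0_mat\<close> and \<open>U0_mat\<close>, which are known binomials; the Stirling sums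
      then act on these.\<close>
    also have "\<dots> = (\<Sum>k=1..j. (\<Sum>m=1..i. L0_mat i m * U0_mat m k) * f k)"
      by (subst sum.swap) (simp add: sum_distrib_right)
    also have "\<dots> = (\<Sum>k=1..j. xvar ^ i * (of_nat ((i + k - 1) choose (k - 1)) * f k)
        + (- 1) ^ k * of_nat ((i - 1) choose (k - 1)) * f k)"
      by (intro sum.cong refl) (subst L0_U0_product[OF i], auto simp: algebra_simps)
    also have "\<dots> = xvar ^ i * (\<Sum>k=1..j. of_nat ((i + k - 1) choose (k - 1)) * f k)
        + (\<Sum>k=1..j. (- 1) ^ k * of_nat ((i - 1) choose (k - 1)) * f k)"
      by (simp only: sum.distrib sum_distrib_left)
    also have "\<dots> = M0_mat i j"
      unfolding f_def sum_Stirling_binomial_shifted[OF i j] sum_Stirling_binomial_alternating[OF i j]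
      by (simp add: M0_mat_def algebra_simps)
    finally show "(M0_mat i j :: 'k poly fract) = (L0_mat \<odot> (U0_mat \<odot> F_mat \<odot> Sigma_mat)) i j" ..
  qed
qed

text \<open>By triangularity the diagonal entry is the single term (x-1)^i (i-1)!, nonzero in
  characteristic zero. This provides the pivots for uniqueness.\<close>

lemma U0_F_Sigma_diagonal_nonzero:
  assumes "i \<ge> 1"
  shows "(U0_mat \<odot> F_mat \<odot> Sigma_mat) i i \<noteq> (0 :: 'k::field_char_0 poly fract)"
proof -
  have "(U0_mat \<odot> F_mat \<odot> Sigma_mat) i i
      = (\<Sum>k\<in>{i}. U0_mat i k * (fact (k - 1) * ((- 1) ^ (k + i) * of_nat (Stirling i k))) :: 'k poly fract)"
    unfolding U0_F_Sigma_eq[OF assms]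
    by (rule sum.mono_neutral_right) (use assms in \<open>auto simp: U0_mat_def\<close>)
  also have "\<dots> = (xvar - 1) ^ i * fact (i - 1)"
    using assms by (simp add: U0_mat_eq waring_coeff_0_right flip: power_mult_distrib)
  finally show ?thesis using xvar_minus_1_nonzero[where 'k = 'k] by simp
qed

theorem corollary4p5:
  shows "LU_decomposition (M0_mat :: nat \<Rightarrow> nat \<Rightarrow> 'k::field_char_0 poly fract)
           L0_mat (U0_mat \<odot> F_mat \<odot> Sigma_mat)
       \<and> (\<forall>L U. LU_decomposition (M0_mat :: nat \<Rightarrow> nat \<Rightarrow> 'k poly fract) L U
            \<longrightarrow> imat_eq L L0_mat \<and> imat_eq U (U0_mat \<odot> F_mat \<odot> Sigma_mat))"
  using LU_decomposition_M0 LU_decomposition_unique[OF _ LU_decomposition_M0 U0_F_Sigma_diagonal_nonzero]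
  by blast

end
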